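(* Let $M(\theta)$ be the nonsingular-chart vertex Kirchhoff matrix of the crossed graph $G_\times$, let $\vartheta\in\mathbb R^7$ represent a phase vector with no component in $\pi\mathbb Z$, and suppose $M(\vartheta)\phi=0$ with $\phi\ne0$. For any positive metric $\ell=\vartheta+2\pi N\in(0,\infty)^7$ with $N\in\mathbb Z_{\ge0}^7$, differentiating along the radial phase path $k\mapsto k\ell$ gives $$\phi^{*}\,\frac{d}{dk}M(k\ell)\bigg|_{k=1}\phi=\sum_{e\in E}\ell_er_e>0,$$ where $r_e$ is the edge energy of the scalar state corresponding to $\phi$. Consequently, when $\ker M(\vartheta)$ is one dimensional, the simple secular eigenvalue branch (the real-analytic eigenvalue branch $\lambda(k)$ of $M(k\ell)$ with $\lambda(1)=0$) crosses zero transversely at $k=1$, i.e. $\lambda'(1)\neq0$.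
   Context: $G_\times$ has internal vertices $v_1,\dots,v_4$ with standard Kirchhoff conditions, two exterior Dirichlet vertices $b_2,b_4$, and edges $E$: $e_{12}=v_1v_2$, $e_{23}=v_2v_3$, $e_{34}=v_3v_4$, $e_{13}=v_1v_3$, $e_{14}=v_1v_4$, $e_{\mathrm{ext},2}=v_2b_2$, $e_{\mathrm{ext},4}=v_4b_4$. For $\theta$ with no component in $\pi\mathbb Z$, $M(\theta)$ is the real symmetric $4\times4$ matrix indexed by $v_1,\dots,v_4$ obtained by summing, for each internal--internal edge $e=vw$, the $2\times2$ block with diagonal entries $-\cot\theta_e$ and off-diagonal entries $\csc\theta_e$ on the coordinates $v,w$, and, for each Dirichlet terminal edge $e$ at $v$, the term $-\cot\theta_e$ in the $(v,v)$ entry. The scalar state corresponding to $\phi\in\ker M(\vartheta)$ has vertex values $\phi_v$ and normalized outward derivatives $p_{v,e}=(\phi_w-\phi_v\cos\vartheta_e)/\sin\vartheta_e$ for an internal--internal edge $e=vw$, and $p_{v,e}=-\phi_v\cot\vartheta_e$ for a Dirichlet terminal edge at $v$. Its edge energy is $r_e=|\phi_v|^2+|p_{v,e}|^2$ (the same at both internal endpoints of $e$). *)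

theory Defs
  imports "HOL-Analysis.Analysis"
begin

section \<open>The crossed graph\<close>

datatype vertex = V1 | V2 | V3 | V4

datatype bdry_vertex = B2 | B4

datatype edge = E12 | E23 | E34 | E13 | E14 | Ext2 | Ext4

datatype edge_ends = Internal vertex vertex | Terminal vertex bdry_vertex

fun ends :: "edge \<Rightarrow> edge_ends" where
  "ends E12 = Internal V1 V2"
| "ends E23 = Internal V2 V3"
| "ends E34 = Internal V3 V4"
| "ends E13 = Internal V1 V3"
| "ends E14 = Internal V1 V4"
| "ends Ext2 = Terminal V2 B2"
| "ends Ext4 = Terminal V4 B4"

lemma UNIV_vertex: "UNIV = {V1, V2, V3, V4}"
  using vertex.exhaust by auto

lemma UNIV_edge: "UNIV = {E12, E23, E34, E13, E14, Ext2, Ext4}"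
  using edge.exhaust by auto

instance vertex :: finite
  by standard (simp add: UNIV_vertex)

instance edge :: finite
  by standard (simp add: UNIV_edge)


section \<open>The vertex Kirchhoff matrix\<close>

text \<open>Phases and lengths are vectors of type \<open>real ^ edge\<close>; \<open>1 / sin\<close> is the cosecant.\<close>

definition edge_block :: "edge_ends \<Rightarrow> real \<Rightarrow> real ^ vertex ^ vertex" where
  "edge_block d t = (\<chi> i j. case d of
       Internal v w \<Rightarrow>
         if i = j \<and> (i = v \<or> i = w) then - cot t
         else if (i = v \<and> j = w) \<or> (i = w \<and> j = v) then 1 / sin t
         else 0
     | Terminal v b \<Rightarrow> if i = v \<and> j = v then - cot t else 0)"

definition kirchhoff_matrix :: "real ^ edge \<Rightarrow> real ^ vertex ^ vertex" where
  "kirchhoff_matrix \<theta> = (\<Sum>e\<in>UNIV. edge_block (ends e) (\<theta> $ e))"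

definition nonsingular_phase :: "real ^ edge \<Rightarrow> bool" where
  "nonsingular_phase \<theta> \<longleftrightarrow> (\<forall>e. \<forall>n::int. \<theta> $ e \<noteq> pi * of_int n)"

text \<open>A real matrix acts on complex vectors through its entrywise embedding.\<close>

definition complex_kernel :: "real ^ 'n ^ 'm \<Rightarrow> (complex ^ 'n) set" where
  "complex_kernel A = {\<phi>. map_matrix complex_of_real A *v \<phi> = 0}"

definition hermitian_form :: "real ^ 'n ^ 'n \<Rightarrow> complex ^ 'n \<Rightarrow> complex" where
  "hermitian_form A \<phi> =
     (\<Sum>v\<in>UNIV. cnj (\<phi> $ v) * (map_matrix complex_of_real A *v \<phi>) $ v)"


section \<open>Scalar states and edge energies\<close>

text \<open>The normalized outward derivative at the internal vertex \<open>v\<close> along the edge \<open>e\<close>;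
  it is meaningful only if \<open>v\<close> is an endpoint of \<open>e\<close>.\<close>

definition outward_deriv :: "real ^ edge \<Rightarrow> complex ^ vertex \<Rightarrow> vertex \<Rightarrow> edge \<Rightarrow> complex" where
  "outward_deriv \<theta> \<phi> v e = (case ends e of
       Internal a b \<Rightarrow>
         (\<phi> $ (if v = a then b else a) - \<phi> $ v * complex_of_real (cos (\<theta> $ e)))
           / complex_of_real (sin (\<theta> $ e))
     | Terminal a d \<Rightarrow> - \<phi> $ v * complex_of_real (cot (\<theta> $ e)))"

definition endpoint_energy :: "real ^ edge \<Rightarrow> complex ^ vertex \<Rightarrow> vertex \<Rightarrow> edge \<Rightarrow> real" where
  "endpoint_energy \<theta> \<phi> v e = (cmod (\<phi> $ v))\<^sup>2 + (cmod (outward_deriv \<theta> \<phi> v e))\<^sup>2"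

text \<open>The energy is evaluated at the first listed endpoint; \<open>edge_energy_endpoint\<close> below
  shows that the choice of internal endpoint is immaterial.\<close>

definition edge_energy :: "real ^ edge \<Rightarrow> complex ^ vertex \<Rightarrow> edge \<Rightarrow> real" where
  "edge_energy \<theta> \<phi> e = (case ends e of
       Internal v w \<Rightarrow> endpoint_energy \<theta> \<phi> v e
     | Terminal v b \<Rightarrow> endpoint_energy \<theta> \<phi> v e)"

lemma energy_swap:
  fixes x y :: complex and c s :: real
  assumes "s \<noteq> 0" "c\<^sup>2 + s\<^sup>2 = 1"
  shows "(cmod x)\<^sup>2 + (cmod ((y - x * of_real c) / of_real s))\<^sup>2
       = (cmod y)\<^sup>2 + (cmod ((x - y * of_real c) / of_real s))\<^sup>2"
proof -
  have key: "s\<^sup>2 * (cmod u)\<^sup>2 + (cmod (w - u * of_real c))\<^sup>2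
           = (cmod u)\<^sup>2 + (cmod w)\<^sup>2 - 2 * c * (Re u * Re w + Im u * Im w)" for u w :: complex
  proof -
    have "s\<^sup>2 = 1 - c\<^sup>2" using assms(2) by simp
    then show ?thesis
      by (simp only: cmod_power2) (simp add: power2_eq_square algebra_simps)
  qed
  have scale: "s\<^sup>2 * ((cmod u)\<^sup>2 + (cmod ((w - u * of_real c) / of_real s))\<^sup>2)
      = s\<^sup>2 * (cmod u)\<^sup>2 + (cmod (w - u * of_real c))\<^sup>2" for u w :: complex
    using assms(1) by (simp add: norm_divide power_divide distrib_left)
  have "s\<^sup>2 * ((cmod x)\<^sup>2 + (cmod ((y - x * of_real c) / of_real s))\<^sup>2)
      = s\<^sup>2 * ((cmod y)\<^sup>2 + (cmod ((x - y * of_real c) / of_real s))\<^sup>2)"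
    unfolding scale key by (simp add: algebra_simps)
  then show ?thesis using assms(1) by simp
qed

lemma edge_energy_endpoint:
  assumes "nonsingular_phase \<theta>" "ends e = Internal v w" "u = v \<or> u = w"
  shows "edge_energy \<theta> \<phi> e = endpoint_energy \<theta> \<phi> u e"
proof -
  have "sin (\<theta> $ e) \<noteq> 0"
    using assms(1) unfolding nonsingular_phase_def sin_zero_iff_int2 by (metis mult.commute)
  from energy_swap[OF this, of "cos (\<theta> $ e)" "\<phi> $ v" "\<phi> $ w"] show ?thesis
    using assms(2,3) by (auto simp: edge_energy_def endpoint_energy_def outward_deriv_def)
qed


section \<open>Analytic eigenvalue branches\<close>

definition real_analytic_at :: "(real \<Rightarrow> real) \<Rightarrow> real \<Rightarrow> bool" where
  "real_analytic_at f x \<longleftrightarrow>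
     (\<exists>a. \<exists>r>0. \<forall>y. \<bar>y - x\<bar> < r \<longrightarrow> (\<lambda>n. a n * (y - x) ^ n) sums f y)"

definition is_eigenvalue :: "real ^ 'n ^ 'n \<Rightarrow> real \<Rightarrow> bool" where
  "is_eigenvalue A \<mu> \<longleftrightarrow> (\<exists>x. x \<noteq> 0 \<and> A *v x = \<mu> *\<^sub>R x)"

text \<open>A branch is only relevant as a germ: its values away from \<open>k\<^sub>0\<close> are unconstrained.\<close>

definition analytic_eigenvalue_branch ::
    "(real \<Rightarrow> real ^ 'n ^ 'n) \<Rightarrow> real \<Rightarrow> (real \<Rightarrow> real) \<Rightarrow> bool" where
  "analytic_eigenvalue_branch A k\<^sub>0 f \<longleftrightarrow>
     real_analytic_at f k\<^sub>0 \<and> (\<forall>\<^sub>F k in nhds k\<^sub>0. is_eigenvalue (A k) (f k))"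

end

theory Submission
  imports Defs "HOL-Complex_Analysis.Cauchy_Integral_Formula"
begin

text \<open>
  Differentiating one edge block in its phase replaces \<open>- cot\<close> by \<open>1 / sin\<^sup>2\<close> and \<open>1 / sin\<close> by
  \<open>- cos / sin\<^sup>2\<close>. The quadratic form of the result at \<open>\<phi>\<close> is a sum of two squares after
  using \<open>sin\<^sup>2 + cos\<^sup>2 = 1\<close>, and these squares are the vertex value and the normalized outward
  derivative: it is the edge energy (\<open>hermitian_form_edge_block_deriv\<close>). Along \<open>k \<mapsto> k l\<close> the
  chain rule contributes the weight \<open>l\<^sub>e\<close>, which gives the identity.
  The sum is positive because a vertex with nonzero value gives positive energy to
  its edges (\<open>weighted_edge_energy_pos\<close>).

  For the eigenvalue branch, \<open>k \<mapsto> M(k l)\<close> extends holomorphically to complex \<open>k\<close>, and a general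
  statement about a simple kernel applies (\<open>simple_eigenvalue_analytic_branch\<close>). Consider
  \<open>G(z, v, w) = (z, H(z) v - w v, \<psi> \<cdot> v)\<close>, where \<open>\<psi>\<close> is a real vector spanning the kernel
  and \<open>H\<close> is the extended matrix family. The derivative of \<open>G\<close> at \<open>(k\<^sub>0, \<psi>, 0)\<close> is injective:
  symmetry makes the range of \<open>M\<close> orthogonal to \<open>\<psi>\<close>, which removes the variation of \<open>w\<close>, and the last
  coordinate removes the remaining multiple of \<open>\<psi>\<close>. The inverse function theorem then solves
  \<open>G = (z, 0, \<psi> \<cdot> \<psi>)\<close> by a normalized eigenpair \<open>v(z), w(z)\<close> (\<open>holomorphic_eigenpair\<close>), and \<open>w\<close> is
  holomorphic since the derivative of \<open>G\<close> is complex linear. Its restriction to the real axis has a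
  convergent power series, and it is real because conjugation preserves the equations.

  Local injectivity of \<open>G\<close> also gives uniqueness, once eigenvectors of any competing branch are known
  to be close to \<open>\<psi>\<close> after normalization (\<open>eventually_eigenvector_near_kernel\<close>). Pairing
  the differentiated eigenvalue equation with \<open>\<psi>\<close> shows that the slope of the branch is
  \<open>\<psi> \<cdot> M' \<psi> / \<psi> \<cdot> \<psi>\<close>, whose numerator is the positive energy sum of the state of \<open>\<psi>\<close>.
\<close>

section \<open>Calculus and linear algebra of coordinate vectors\<close>

lemma bounded_linear_axis: "bounded_linear (axis i :: 'a::real_normed_vector \<Rightarrow> 'a ^ 'n)"
proof (rule bounded_linear_intro[where K = 1])
  show "norm (axis i x :: 'a ^ 'n) \<le> norm x * 1" for x :: 'a
  proof -
    have "(\<lambda>j. norm ((axis i x :: 'a ^ 'n) $ j)) = (\<lambda>j. if j = i then norm x else 0)"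
      by (auto simp: axis_def)
    then have "norm (axis i x :: 'a ^ 'n) \<le> (\<Sum>j\<in>UNIV. if j = i then norm x else 0)"
      unfolding norm_vec_def by (metis L2_set_le_sum norm_ge_zero)
    then show ?thesis by simp
  qed
qed (auto simp: axis_def vec_eq_iff)

lemma has_derivative_vec:
  fixes f :: "'a::real_normed_vector \<Rightarrow> 'b::real_normed_vector ^ 'n"
  assumes "\<And>i. ((\<lambda>x. f x $ i) has_derivative (\<lambda>h. f' h $ i)) F"
  shows "(f has_derivative f') F"
proof -
  have expand: "(\<Sum>i\<in>UNIV. axis i (u $ i)) = u" for u :: "'b ^ 'n"
    by (simp add: vec_eq_iff axis_def sum_component)
  have "((\<lambda>x. \<Sum>i\<in>UNIV. axis i (f x $ i)) has_derivative (\<lambda>h. \<Sum>i\<in>UNIV. axis i (f' h $ i))) F"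
    by (intro has_derivative_sum bounded_linear.has_derivative[OF bounded_linear_axis] assms)
  then show ?thesis by (simp add: expand)
qed

lemma has_vector_derivative_vec:
  fixes f :: "real \<Rightarrow> 'b::real_normed_vector ^ 'n"
  assumes "\<And>i. ((\<lambda>x. f x $ i) has_vector_derivative f' $ i) F"
  shows "(f has_vector_derivative f') F"
  using assms unfolding has_vector_derivative_def by (intro has_derivative_vec) simp

lemma continuous_on_vec:
  assumes "\<And>i. continuous_on S (\<lambda>x. f x $ i)"
  shows "continuous_on S f"
  using continuous_on_vec_lambda[of S "\<lambda>i x. f x $ i"] assms by simp

definition cvec :: "real ^ 'n \<Rightarrow> complex ^ 'n" where
  "cvec x = (\<chi> i. of_real (x $ i))"

lemma cvec_nth [simp]: "cvec x $ i = of_real (x $ i)"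
  by (simp add: cvec_def)

lemma map_matrix_cvec: "map_matrix of_real A *v cvec x = cvec (A *v x)"
  by (simp add: vec_eq_iff matrix_vector_mult_def)

lemma hermitian_form_cvec: "hermitian_form A (cvec x) = of_real (x \<bullet> (A *v x))"
  by (simp add: hermitian_form_def map_matrix_cvec inner_vec_def)

lemma real_kernel_Re_Im:
  assumes "map_matrix complex_of_real A *v x = 0"
  shows "A *v (\<chi> i. Re (x $ i)) = 0" "A *v (\<chi> i. Im (x $ i)) = 0"
proof -
  have "(\<Sum>j\<in>UNIV. of_real (A $ i $ j) * x $ j) = 0" for i
    using assms by (simp add: matrix_vector_mult_def vec_eq_iff)
  from arg_cong[OF this, of Re] arg_cong[OF this, of Im]
  show "A *v (\<chi> i. Re (x $ i)) = 0" "A *v (\<chi> i. Im (x $ i)) = 0"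
    by (simp_all add: matrix_vector_mult_def vec_eq_iff)
qed

text \<open>The symmetric \<open>A\<close> can be moved onto \<open>\<psi>\<close> in the bilinear pairing, where it gives \<open>0\<close>.\<close>

lemma symmetric_kernel_orthogonal_range:
  assumes "transpose A = A" "A *v \<psi> = 0"
  shows "(\<Sum>i\<in>UNIV. of_real (\<psi> $ i) * (map_matrix complex_of_real A *v x) $ i) = 0"
proof -
  have "A $ i $ j = A $ j $ i" for i j
    using assms(1) by (metis transpose_def vec_lambda_beta)
  then have "(\<Sum>i\<in>UNIV. of_real (\<psi> $ i) * (map_matrix complex_of_real A *v x) $ i)
      = (\<Sum>i\<in>UNIV. \<Sum>j\<in>UNIV. of_real (A $ j $ i * \<psi> $ i) * x $ j)"
    by (auto simp: matrix_vector_mult_def sum_distrib_left mult_ac intro!: sum.cong)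
  also have "\<dots> = (\<Sum>j\<in>UNIV. \<Sum>i\<in>UNIV. of_real (A $ j $ i * \<psi> $ i) * x $ j)"
    by (rule sum.swap)
  also have "\<dots> = (\<Sum>j\<in>UNIV. of_real ((A *v \<psi>) $ j) * x $ j)"
    by (simp add: matrix_vector_mult_def sum_distrib_right)
  finally show ?thesis using assms(2) by simp
qed

lemma sum_of_real_inner:
  "(\<Sum>i\<in>UNIV. of_real (x $ i) * of_real (y $ i)) = complex_of_real (x \<bullet> y)"
  by (simp add: inner_vec_def)

text \<open>The real and imaginary parts of a complex kernel vector lie in the kernel too, so a complex
  kernel line is spanned by a real vector, and real kernel vectors are real multiples of it.\<close>

lemma real_kernel_line:
  fixes A :: "real ^ 'n ^ 'n"
  assumes "\<phi> \<in> complex_kernel A" "\<phi> \<noteq> 0" "vec.dim (complex_kernel A) = 1"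
  obtains \<psi> where "A *v \<psi> = 0" "\<psi> \<noteq> 0" "\<And>x. A *v x = 0 \<Longrightarrow> \<exists>c. x = c *\<^sub>R \<psi>"
proof -
  have "map_matrix of_real A *v \<phi> = 0" using assms(1) by (simp add: complex_kernel_def)
  note real_kernel_Re_Im[OF this]
  moreover have "(\<chi> i. Re (\<phi> $ i)) \<noteq> 0 \<or> (\<chi> i. Im (\<phi> $ i)) \<noteq> 0"
    using assms(2) by (auto simp: vec_eq_iff complex_eq_iff)
  ultimately obtain \<psi> where \<psi>: "A *v \<psi> = 0" "\<psi> \<noteq> 0" by blast
  have kernel: "cvec x \<in> complex_kernel A" if "A *v x = 0" for x
    using that by (simp add: complex_kernel_def map_matrix_cvec vec_eq_iff)
  have "cvec \<psi> \<noteq> 0" using \<psi>(2) by (auto simp: vec_eq_iff)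
  then have span: "complex_kernel A \<subseteq> vec.span {cvec \<psi>}"
    using kernel[OF \<psi>(1)] assms(3) by (intro vec.card_ge_dim_independent) auto
  have "\<exists>c. x = c *\<^sub>R \<psi>" if x: "A *v x = 0" for x
  proof -
    obtain c where "cvec x = c *s cvec \<psi>"
      using span kernel[OF x] by (auto simp: vec.span_singleton)
    then have "complex_of_real (x $ i) = c * of_real (\<psi> $ i)" for i
      by (simp add: vec_eq_iff)
    then have "x $ i = Re c * \<psi> $ i" for i
      by (auto simp: complex_eq_iff)
    then have "x = Re c *\<^sub>R \<psi>" by (simp add: vec_eq_iff)
    then show ?thesis ..
  qed
  with \<psi> show ?thesis by (rule that)
qed

lemma norm_matrix_vector_le:
  fixes A :: "real ^ 'n ^ 'm"
  shows "norm (A *v x) \<le> (\<Sum>i\<in>UNIV. \<Sum>j\<in>UNIV. \<bar>A $ i $ j\<bar>) * norm x"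
proof -
  have "norm (A *v x) \<le> (\<Sum>i\<in>UNIV. \<bar>(A *v x) $ i\<bar>)" by (rule norm_le_l1_cart)
  also have "\<dots> \<le> (\<Sum>i\<in>UNIV. \<Sum>j\<in>UNIV. \<bar>A $ i $ j\<bar> * norm x)"
  proof (rule sum_mono)
    fix i
    have "\<bar>(A *v x) $ i\<bar> \<le> (\<Sum>j\<in>UNIV. \<bar>A $ i $ j * x $ j\<bar>)"
      unfolding matrix_vector_mult_def by (simp add: sum_abs)
    also have "\<dots> \<le> (\<Sum>j\<in>UNIV. \<bar>A $ i $ j\<bar> * norm x)"
      unfolding abs_mult by (intro sum_mono mult_left_mono component_le_norm_cart) auto
    finally show "\<bar>(A *v x) $ i\<bar> \<le> (\<Sum>j\<in>UNIV. \<bar>A $ i $ j\<bar> * norm x)" .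
  qed
  finally show ?thesis by (simp add: sum_distrib_right)
qed

section \<open>The energy identity\<close>

definition edge_block_deriv :: "edge_ends \<Rightarrow> real \<Rightarrow> real ^ vertex ^ vertex" where
  "edge_block_deriv d t = (\<chi> i j. case d of
       Internal v w \<Rightarrow>
         if i = j \<and> (i = v \<or> i = w) then 1 / (sin t)\<^sup>2
         else if (i = v \<and> j = w) \<or> (i = w \<and> j = v) then - cos t / (sin t)\<^sup>2
         else 0
     | Terminal v b \<Rightarrow> if i = v \<and> j = v then 1 / (sin t)\<^sup>2 else 0)"

lemma edge_block_has_vector_derivative:
  assumes "sin t \<noteq> 0"
  shows "(edge_block d has_vector_derivative edge_block_deriv d t) (at t)"
proof (intro has_vector_derivative_vec)
  fix i j
  have 1: "((\<lambda>t. - cot t) has_vector_derivative 1 / (sin t)\<^sup>2) (at t)"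
    using DERIV_minus[OF DERIV_cot[OF assms]]
    by (simp add: has_real_derivative_iff_has_vector_derivative inverse_eq_divide)
  have 2: "((\<lambda>t. 1 / sin t) has_vector_derivative - cos t / (sin t)\<^sup>2) (at t)"
    using assms unfolding has_real_derivative_iff_has_vector_derivative[symmetric]
    by (auto intro!: derivative_eq_intros simp: field_simps power2_eq_square)
  show "((\<lambda>t. edge_block d t $ i $ j) has_vector_derivative edge_block_deriv d t $ i $ j) (at t)"
    using 1 2 by (cases d; cases "i = j") (auto simp: edge_block_def edge_block_deriv_def)
qed

lemma kirchhoff_matrix_has_vector_derivative:
  assumes "\<And>e. sin (l $ e) \<noteq> 0"
  shows "((\<lambda>k. kirchhoff_matrix (k *\<^sub>R l)) has_vector_derivative
           (\<Sum>e\<in>UNIV. l $ e *\<^sub>R edge_block_deriv (ends e) (l $ e))) (at 1)"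
  unfolding kirchhoff_matrix_def
proof (intro has_vector_derivative_sum)
  fix e
  have "((\<lambda>k. k * l $ e) has_vector_derivative l $ e) (at 1)"
    unfolding has_real_derivative_iff_has_vector_derivative[symmetric]
    by (auto intro!: derivative_eq_intros)
  from vector_diff_chain_at[OF this, of "edge_block (ends e)" "edge_block_deriv (ends e) (l $ e)"]
  have "((\<lambda>k. edge_block (ends e) (k * l $ e)) has_vector_derivative
           l $ e *\<^sub>R edge_block_deriv (ends e) (l $ e)) (at 1)"
    using edge_block_has_vector_derivative[OF assms] by (simp add: o_def)
  then show "((\<lambda>k. edge_block (ends e) ((k *\<^sub>R l) $ e)) has_vector_derivative
           l $ e *\<^sub>R edge_block_deriv (ends e) (l $ e)) (at 1)"
    by simp
qed

lemma hermitian_form_expand: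
  "hermitian_form A \<phi> = (\<Sum>i\<in>UNIV. \<Sum>j\<in>UNIV. of_real (A $ i $ j) * (cnj (\<phi> $ i) * \<phi> $ j))"
  unfolding hermitian_form_def by (simp add: matrix_vector_mult_def sum_distrib_left mult_ac)

lemma hermitian_form_add: "hermitian_form (A + B) \<phi> = hermitian_form A \<phi> + hermitian_form B \<phi>"
  by (simp add: hermitian_form_expand sum.distrib distrib_right)

lemma hermitian_form_scaleR: "hermitian_form (c *\<^sub>R A) \<phi> = of_real c * hermitian_form A \<phi>"
  by (simp add: hermitian_form_expand sum_distrib_left mult_ac)

lemma hermitian_form_sum_scaleR:
  "hermitian_form (\<Sum>e\<in>I. c e *\<^sub>R B e) \<phi> = (\<Sum>e\<in>I. of_real (c e) * hermitian_form (B e) \<phi>)"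
proof (induction I rule: infinite_finite_induct)
  case (insert e I)
  then show ?case by (simp add: hermitian_form_add hermitian_form_scaleR)
qed (simp_all add: hermitian_form_expand)

text \<open>On an internal edge with end values \<open>x\<close> and \<open>y\<close>, the form is
  \<open>(\<bar>x\<bar>\<^sup>2 + \<bar>y\<bar>\<^sup>2 - 2 c Re (cnj x y)) / s\<^sup>2\<close>, and completing the square in \<open>y\<close> leaves \<open>\<bar>x\<bar>\<^sup>2\<close> plus
  \<open>\<bar>y - c x\<bar>\<^sup>2 / s\<^sup>2\<close>. A terminal edge is the case \<open>y = 0\<close>.\<close>

lemma hermitian_form_edge_block_deriv:
  assumes "sin (\<theta> $ e) \<noteq> 0"
  shows "hermitian_form (edge_block_deriv (ends e) (\<theta> $ e)) \<phi> = of_real (edge_energy \<theta> \<phi> e)"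
proof -
  define s c where "s = sin (\<theta> $ e)" and "c = cos (\<theta> $ e)"
  have s: "s \<noteq> 0" and sc: "s\<^sup>2 + c\<^sup>2 = 1" using assms by (auto simp: s_def c_def)
  have nn: "cnj u * u = of_real ((cmod u)\<^sup>2)" for u
    by (metis complex_norm_square mult.commute)
  have internal: "of_real (1 / s\<^sup>2) * (cnj x * x) + of_real (- c / s\<^sup>2) * (cnj x * y)
      + (of_real (- c / s\<^sup>2) * (cnj y * x) + of_real (1 / s\<^sup>2) * (cnj y * y))
      = of_real ((cmod x)\<^sup>2 + (cmod ((y - x * of_real c) / of_real s))\<^sup>2)" for x y :: complex
  proof -
    define q where "q = y - x * of_real c"
    have "(of_real s)\<^sup>2 + (of_real c)\<^sup>2 = (1::complex)"
      using sc by (metis of_real_1 of_real_add of_real_power)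
    then have c2: "(of_real c)\<^sup>2 = 1 - (of_real s :: complex)\<^sup>2" by algebra
    have "cnj q * q = cnj x * x * (of_real c)\<^sup>2 - of_real c * (cnj x * y) - of_real c * (cnj y * x) + cnj y * y"
      by (simp add: q_def algebra_simps power2_eq_square)
    then have qq: "cnj q * q = cnj x * x - cnj x * x * (of_real s)\<^sup>2
        - of_real c * (cnj x * y) - of_real c * (cnj y * x) + cnj y * y"
      by (simp only: c2) (simp add: algebra_simps)
    have "of_real ((cmod x)\<^sup>2 + (cmod (q / of_real s))\<^sup>2) = cnj x * x + (cnj q * q) / (of_real s)\<^sup>2"
      unfolding nn by (simp add: norm_divide power_divide)
    also have "\<dots> = (cnj x * x - of_real c * (cnj x * y) - of_real c * (cnj y * x) + cnj y * y) / (of_real s)\<^sup>2"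
      unfolding qq using s by (simp add: field_simps)
    finally show ?thesis unfolding q_def by (simp add: diff_divide_distrib add_divide_distrib)
  qed
  have terminal: "of_real (1 / s\<^sup>2) * (cnj x * x)
      = of_real ((cmod x)\<^sup>2 + (cmod (- x * of_real (c / s)))\<^sup>2)" for x :: complex
  proof -
    have "(cmod x)\<^sup>2 + (cmod (- x * of_real (c / s)))\<^sup>2 = (s\<^sup>2 + c\<^sup>2) / s\<^sup>2 * (cmod x)\<^sup>2"
      using s by (simp add: norm_mult norm_divide power_mult_distrib power_divide field_simps)
    then show ?thesis
      unfolding sc nn by (simp only: of_real_mult)
  qed
  note defs = hermitian_form_expand edge_block_deriv_def edge_energy_def endpoint_energy_def
    outward_deriv_def UNIV_vertex cot_def
  show ?thesis
    using internal terminal unfolding s_def c_def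
    by (cases e) (simp_all add: defs)
qed

text \<open>Every vertex is the first listed endpoint of some edge, at which the energy is evaluated,
  so a nonzero vertex value is seen by at least one summand.\<close>

lemma weighted_edge_energy_pos:
  assumes "\<phi> \<noteq> 0" "\<forall>e. l $ e > 0"
  shows "(\<Sum>e\<in>UNIV. l $ e * edge_energy \<theta> \<phi> e) > 0"
proof -
  have nonneg: "edge_energy \<theta> \<phi> e \<ge> 0" for e
    by (auto simp: edge_energy_def endpoint_energy_def split: edge_ends.split)
  obtain v where v: "\<phi> $ v \<noteq> 0" using assms(1) by (auto simp: vec_eq_iff)
  have "\<exists>e. (case ends e of Internal a b \<Rightarrow> a | Terminal a b \<Rightarrow> a) = v"
    by (cases v) (auto intro: exI[of _ E12] exI[of _ E23] exI[of _ E34] exI[of _ Ext4])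
  then obtain e where "(case ends e of Internal a b \<Rightarrow> a | Terminal a b \<Rightarrow> a) = v" ..
  then have "edge_energy \<theta> \<phi> e = endpoint_energy \<theta> \<phi> v e"
    by (auto simp: edge_energy_def split: edge_ends.splits)
  also have "\<dots> > 0" using v by (simp add: endpoint_energy_def add_pos_nonneg)
  finally have "l $ e * edge_energy \<theta> \<phi> e > 0" using assms(2) by simp
  then show ?thesis
    using assms(2) nonneg by (intro sum_pos2[of _ e]) (simp_all add: less_imp_le)
qed

section \<open>The normalized eigenvalue equation\<close>

text \<open>For \<open>v \<noteq> 0\<close> the second component vanishes exactly at the eigenpairs of \<open>H z\<close>.
  The third component is bilinear, not sesquilinear, in order to be holomorphic in \<open>v\<close>; the first one records the parameter
  so that source and target have the same dimension.\<close>

definition pencil_map ::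
    "(complex \<Rightarrow> complex ^ 'n ^ 'n) \<Rightarrow> real ^ 'n \<Rightarrow> complex \<times> (complex ^ 'n) \<times> complex \<Rightarrow> complex \<times> (complex ^ 'n) \<times> complex" where
  "pencil_map H \<psi> = (\<lambda>(z, v, w). (z, H z *v v - w *s v, \<Sum>i\<in>UNIV. of_real (\<psi> $ i) * v $ i))"

definition pencil_deriv ::
    "(complex \<Rightarrow> complex ^ 'n ^ 'n) \<Rightarrow> (complex \<Rightarrow> complex ^ 'n ^ 'n) \<Rightarrow> real ^ 'n
      \<Rightarrow> complex \<times> (complex ^ 'n) \<times> complex \<Rightarrow> complex \<times> (complex ^ 'n) \<times> complex \<Rightarrow> complex \<times> (complex ^ 'n) \<times> complex" where
  "pencil_deriv H H' \<psi> = (\<lambda>(z, v, w) (h, dv, dw).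
     (h, h *s (H' z *v v) + H z *v dv - dw *s v - w *s dv, \<Sum>i\<in>UNIV. of_real (\<psi> $ i) * dv $ i))"

lemma pencil_map_has_derivative:
  assumes "\<And>i j. ((\<lambda>z. H z $ i $ j) has_field_derivative H' (fst p) $ i $ j) (at (fst p))"
  shows "(pencil_map H \<psi> has_derivative pencil_deriv H H' \<psi> p) (at p)"
proof -
  have H: "((\<lambda>q. H (fst q) $ i $ j) has_derivative (\<lambda>q. fst q * H' (fst p) $ i $ j)) (at p)" for i j
    using has_derivative_compose[OF has_derivative_fst[OF has_derivative_ident]
        assms[of i j, unfolded has_field_derivative_def]]
    by (simp add: mult.commute)
  have v: "((\<lambda>q. fst (snd q) $ i) has_derivative (\<lambda>q. fst (snd q) $ i)) (at p)"
    for p :: "complex \<times> (complex ^ 'n) \<times> complex" and i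
    by (intro bounded_linear.has_derivative[OF bounded_linear_vec_nth] derivative_intros)
  note [derivative_intros] = H v
  have "((\<lambda>q. (fst q, H (fst q) *v fst (snd q) - snd (snd q) *s fst (snd q),
            \<Sum>i\<in>UNIV. of_real (\<psi> $ i) * fst (snd q) $ i)) has_derivative
         (\<lambda>q. (fst q, fst q *s (H' (fst p) *v fst (snd p)) + H (fst p) *v fst (snd q)
                - snd (snd q) *s fst (snd p) - snd (snd p) *s fst (snd q),
               \<Sum>i\<in>UNIV. of_real (\<psi> $ i) * fst (snd q) $ i))) (at p)"
  proof (intro has_derivative_Pair has_derivative_vec)
    show "((\<lambda>q. (H (fst q) *v fst (snd q) - snd (snd q) *s fst (snd q)) $ i) has_derivative
         (\<lambda>q. (fst q *s (H' (fst p) *v fst (snd p)) + H (fst p) *v fst (snd q)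
                - snd (snd q) *s fst (snd p) - snd (snd p) *s fst (snd q)) $ i)) (at p)" for i
      unfolding matrix_vector_mult_def
      by (auto intro!: derivative_eq_intros ext simp: algebra_simps sum.distrib sum_distrib_left)
  qed (auto intro!: derivative_eq_intros)
  then show ?thesis
    by (simp add: pencil_map_def pencil_deriv_def case_prod_unfold)
qed

text \<open>The expression is jointly complex linear in the increment. Only multiples of preimages of
  \<open>(1, 0, 0)\<close> matter for the complex derivative of the solution in the parameter.\<close>

lemma pencil_deriv_cscale:
  assumes "pencil_deriv H H' \<psi> p (1, dv, dw) = (1, 0, 0)"
  shows "pencil_deriv H H' \<psi> p (c, c *s dv, c * dw) = (c, 0, 0)"
proof -
  obtain z v w where p: "p = (z, v, w)" by (cases p)
  from assms have e: "(H' z *v v + H z *v dv - dw *s v - w *s dv) $ i = 0" for i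
    by (simp add: p pencil_deriv_def)
  have "(c *s (H' z *v v) + H z *v (c *s dv) - (c * dw) *s v - w *s (c *s dv)) $ i
      = c * (H' z *v v + H z *v dv - dw *s v - w *s dv) $ i" for i
    by (simp add: vec.scale algebra_simps)
  moreover have "(\<Sum>i\<in>UNIV. of_real (\<psi> $ i) * (c *s dv) $ i) = c * (\<Sum>i\<in>UNIV. of_real (\<psi> $ i) * dv $ i)"
    by (simp add: sum_distrib_left mult_ac)
  ultimately show ?thesis using assms e by (simp add: p pencil_deriv_def vec_eq_iff)
qed

lemma pencil_deriv_continuous:
  assumes "\<And>i j. continuous_on S (\<lambda>z. H z $ i $ j)" "\<And>i j. continuous_on S (\<lambda>z. H' z $ i $ j)"
  shows "continuous_on (S \<times> UNIV) (\<lambda>p. pencil_deriv H H' \<psi> p q)"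
proof -
  have c: "continuous_on (S \<times> UNIV) (\<lambda>p :: complex \<times> (complex ^ 'n) \<times> complex. K (fst p) $ i $ j)"
    if "\<And>i j. continuous_on S (\<lambda>z. K z $ i $ j)" for K :: "complex \<Rightarrow> complex ^ 'n ^ 'n" and i j
    by (rule continuous_on_compose2[OF that continuous_on_fst[OF continuous_on_id]]) auto
  have n: "continuous_on (S \<times> UNIV) (\<lambda>p :: complex \<times> (complex ^ 'n) \<times> complex. fst (snd p) $ i)" for i
    by (intro continuous_on_component continuous_intros)
  show ?thesis
    unfolding pencil_deriv_def case_prod_unfold
    by (intro continuous_on_Pair continuous_on_const continuous_on_vec)
      (auto simp: matrix_vector_mult_def intro!: continuous_intros c[OF assms(1)] c[OF assms(2)] n)
qed

text \<open>Injectivity at a simple kernel: pairing the linearized equation with \<open>\<psi>\<close> kills \<open>A dv\<close> by symmetry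
  and forces \<open>dw = 0\<close>; then \<open>dv\<close> lies on the kernel line, and the normalization excludes it.\<close>

lemma pencil_deriv_inj:
  assumes A: "H z = map_matrix of_real A" "transpose A = A" "A *v \<psi> = 0" "\<psi> \<noteq> 0"
    and ker: "\<And>x. A *v x = 0 \<Longrightarrow> \<exists>c. x = c *\<^sub>R \<psi>"
    and 0: "pencil_deriv H H' \<psi> (z, cvec \<psi>, 0) (h, dv, dw) = (0, 0, 0)"
  shows "h = 0 \<and> dv = 0 \<and> dw = 0"
proof -
  from 0 have h: "h = 0" by (simp add: pencil_deriv_def)
  from 0 have orth: "(\<Sum>i\<in>UNIV. of_real (\<psi> $ i) * dv $ i) = 0"
    by (simp add: pencil_deriv_def)
  from 0 h have eq: "map_matrix of_real A *v dv = dw *s cvec \<psi>"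
    by (simp add: pencil_deriv_def A(1) vec_eq_iff)
  have "0 = (\<Sum>i\<in>UNIV. of_real (\<psi> $ i) * (dw *s cvec \<psi>) $ i)"
    using symmetric_kernel_orthogonal_range[OF A(2,3), of dv] eq by simp
  also have "\<dots> = dw * (\<Sum>i\<in>UNIV. of_real (\<psi> $ i) * of_real (\<psi> $ i))"
    by (simp add: sum_distrib_left mult_ac)
  finally have dw: "dw = 0" using A(4) unfolding sum_of_real_inner by simp
  have zero: "x = 0" if x: "A *v x = 0" "\<psi> \<bullet> x = 0" for x
  proof -
    obtain c where "x = c *\<^sub>R \<psi>" using ker[OF x(1)] by blast
    then show ?thesis using x(2) A(4) by simp
  qed
  have "map_matrix of_real A *v dv = 0" using eq dw by (simp add: vec_eq_iff)
  note real_kernel_Re_Im[OF this]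
  moreover have "\<psi> \<bullet> (\<chi> i. Re (dv $ i)) = 0" "\<psi> \<bullet> (\<chi> i. Im (dv $ i)) = 0"
    using arg_cong[OF orth, of Re] arg_cong[OF orth, of Im] by (simp_all add: inner_vec_def)
  ultimately have "(\<chi> i. Re (dv $ i)) = 0" "(\<chi> i. Im (dv $ i)) = 0"
    using zero by blast+
  then have "dv = 0" by (simp add: vec_eq_iff complex_eq_iff)
  with h dw show ?thesis by blast
qed

text \<open>The neighbourhood \<open>U\<close> on which the equation has unique solutions is part of the conclusion,
  because both the reality of the eigenvalue at real parameters and the uniqueness of the branch
  are deduced from injectivity there.\<close>

lemma holomorphic_eigenpair:
  fixes H :: "complex \<Rightarrow> complex ^ 'n ^ 'n" and A :: "real ^ 'n ^ 'n" and \<psi> :: "real ^ 'n"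
  defines "H' \<equiv> \<lambda>z. \<chi> i j. deriv (\<lambda>z. H z $ i $ j) z"
  assumes S: "open S" "z0 \<in> S" and hol: "\<And>i j. (\<lambda>z. H z $ i $ j) holomorphic_on S"
    and A: "H z0 = map_matrix of_real A" "transpose A = A" "A *v \<psi> = 0" "\<psi> \<noteq> 0"
    and ker: "\<And>x. A *v x = 0 \<Longrightarrow> \<exists>c. x = c *\<^sub>R \<psi>"
  obtains U r w v where "open U" "(z0, cvec \<psi>, 0) \<in> U" "inj_on (pencil_map H \<psi>) U"
    "r > 0" "w holomorphic_on ball z0 r" "continuous_on (ball z0 r) v" "v z0 = cvec \<psi>" "w z0 = 0"
    "\<And>z. z \<in> ball z0 r \<Longrightarrow> (z, v z, w z) \<in> U"
    "\<And>z. z \<in> ball z0 r \<Longrightarrow> pencil_map H \<psi> (z, v z, w z) = (z, 0, of_real (\<psi> \<bullet> \<psi>))"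
    "deriv w z0 * of_real (\<psi> \<bullet> \<psi>) = (\<Sum>i\<in>UNIV. of_real (\<psi> $ i) * (H' z0 *v cvec \<psi>) $ i)"
proof -
  let ?G = "pencil_map H \<psi>" and ?G' = "pencil_deriv H H' \<psi>"
  define p0 :: "complex \<times> (complex ^ 'n) \<times> complex" where "p0 = (z0, cvec \<psi>, 0)"
  define Y :: "complex \<Rightarrow> complex \<times> (complex ^ 'n) \<times> complex"
    where "Y z = (z, 0, of_real (\<psi> \<bullet> \<psi>))" for z
  define f' where "f' p = Blinfun (?G' p)" for p
  have H': "((\<lambda>z. H z $ i $ j) has_field_derivative H' z $ i $ j) (at z)" if "z \<in> S" for z i j
    using holomorphic_derivI[OF hol S(1) that] by (simp add: H'_def)
  have der: "(?G has_derivative ?G' p) (at p)" if "p \<in> S \<times> UNIV" for p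
    using that by (intro pencil_map_has_derivative H') auto
  have bl: "bounded_linear (?G' p)" if "p \<in> S \<times> UNIV" for p
    using der[OF that] by (rule has_derivative_bounded_linear)
  have f': "blinfun_apply (f' p) = ?G' p" if "p \<in> S \<times> UNIV" for p
    unfolding f'_def by (rule bounded_linear_Blinfun_apply[OF bl[OF that]])
  have der': "(?G has_derivative f' p) (at p)" if "p \<in> S \<times> UNIV" for p
    using der[OF that] f'[OF that] by simp
  have cont: "continuous_on (S \<times> UNIV) f'"
  proof (rule continuous_on_blinfun_componentwise)
    have "(\<lambda>z. H' z $ i $ j) holomorphic_on S" for i j
      using holomorphic_deriv[OF hol S(1)] by (simp add: H'_def)
    then have "continuous_on (S \<times> UNIV) (\<lambda>p. ?G' p q)" for q
      by (intro pencil_deriv_continuous holomorphic_on_imp_continuous_on hol)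
    then show "continuous_on (S \<times> UNIV) (\<lambda>p. f' p q)" for q
      by (rule continuous_on_eq) (simp add: f')
  qed
  have p0: "p0 \<in> S \<times> UNIV" using S(2) by (simp add: p0_def)
  have lin: "linear (?G' p0)" using bl[OF p0] by (rule bounded_linear.linear)
  have "inj (?G' p0)"
    using linear_injective_0[OF lin] pencil_deriv_inj[of H z0 A \<psi> H', OF A ker] by (auto simp: p0_def zero_prod_def)
  then obtain i0 where "linear i0" "i0 \<circ> ?G' p0 = id"
    using linear_injective_left_inverse[OF lin] by blast
  then have inv: "Blinfun i0 o\<^sub>L f' p0 = id_blinfun"
    by (intro blinfun_eqI)
      (simp add: f'[OF p0] bounded_linear_Blinfun_apply linear_conv_bounded_linear[symmetric] pointfree_idE)
  obtain U V g g' where U: "open U" "U \<subseteq> S \<times> UNIV" "p0 \<in> U" and V: "open V" "?G p0 \<in> V"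
    and hom: "homeomorphism U V ?G g"
    and g': "\<And>y. y \<in> V \<Longrightarrow> (g has_derivative g' y) (at y)"
    and inv': "\<And>y. y \<in> V \<Longrightarrow> g' y = inv (blinfun_apply (f' (g y)))"
    and bij: "\<And>y. y \<in> V \<Longrightarrow> bij (blinfun_apply (f' (g y)))"
    using inverse_function_theorem[OF open_Times[OF S(1) open_UNIV] der' cont p0 inv] by metis
  have Gg: "?G (g y) = y" and gU: "g y \<in> U" if "y \<in> V" for y
    using hom that by (auto simp: homeomorphism_def)
  have gG: "g (?G p) = p" if "p \<in> U" for p
    using hom that by (auto simp: homeomorphism_def)
  have inj: "inj_on ?G U" by (metis gG inj_onI)
  have Gp0: "?G p0 = Y z0"
    using A(3) by (simp add: p0_def Y_def pencil_map_def A(1) map_matrix_cvec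
        sum_of_real_inner vec_eq_iff)
  have Yc: "continuous_on UNIV Y" unfolding Y_def by (intro continuous_intros)
  have "open (Y -` V)" using V(1) Yc by (simp add: open_vimage)
  then obtain r where r: "r > 0" "ball z0 r \<subseteq> Y -` V"
    using V(2) Gp0 by (metis openE vimageI)
  then have YV: "Y z \<in> V" if "z \<in> ball z0 r" for z using that by auto
  define v where "v z = fst (snd (g (Y z)))" for z
  define w where "w z = snd (snd (g (Y z)))" for z
  have gY: "g (Y z) = (z, v z, w z)" if "z \<in> ball z0 r" for z
  proof -
    have "fst (?G (g (Y z))) = z" using Gg[OF YV[OF that]] by (simp add: Y_def)
    then have "fst (g (Y z)) = z" by (simp add: pencil_map_def case_prod_unfold)
    then show ?thesis by (simp add: v_def w_def prod_eq_iff)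
  qed
  have base: "v z0 = cvec \<psi>" "w z0 = 0"
    using gG[OF U(3)] Gp0 by (auto simp: v_def w_def p0_def)
  have "continuous_on V g" using hom by (simp add: homeomorphism_def)
  then have "continuous_on (ball z0 r) (\<lambda>z. g (Y z))"
    using YV by (intro continuous_on_compose2[OF _ continuous_on_subset[OF Yc]]) auto
  then have vc: "continuous_on (ball z0 r) v"
    unfolding v_def by (intro continuous_intros)
  have wder: "\<exists>dv dw. (w has_field_derivative dw) (at z) \<and> ?G' (z, v z, w z) (1, dv, dw) = (1, 0, 0)"
    if z: "z \<in> ball z0 r" for z
  proof -
    have pS: "(z, v z, w z) \<in> S \<times> UNIV" using gU[OF YV[OF z]] U(2) gY[OF z] by auto
    have g'_inv: "g' (Y z) = inv (?G' (z, v z, w z))" and b: "bij (?G' (z, v z, w z))"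
      using inv'[OF YV[OF z]] bij[OF YV[OF z]] f'[OF pS] gY[OF z] by simp_all
    obtain a dv dw where d: "g' (Y z) (1, 0, 0) = (a, dv, dw)" by (metis prod_cases3)
    then have "?G' (z, v z, w z) (a, dv, dw) = (1, 0, 0)"
      using b g'_inv by (metis bij_inv_eq_iff)
    moreover from this have "a = 1" by (simp add: pencil_deriv_def)
    ultimately have 1: "?G' (z, v z, w z) (1, dv, dw) = (1, 0, 0)" by simp
    \<comment> \<open>The real derivative of the inverse is complex linear along the first axis,
      because the preimages of \<open>(c, 0, 0)\<close> under the injective \<open>?G'\<close> scale with \<open>c\<close>.\<close>
    have g'c: "g' (Y z) (c, 0, 0) = (c, c *s dv, c * dw)" for c
      using pencil_deriv_cscale[OF 1, of c] b g'_inv by (metis bij_inv_eq_iff)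
    have "(Y has_derivative (\<lambda>h. (h, 0, 0))) (at z)"
      unfolding Y_def by (intro derivative_intros)
    from has_derivative_compose[OF this g'[OF YV[OF z]]]
    have "((\<lambda>z. g (Y z)) has_derivative (\<lambda>c. (c, c *s dv, c * dw))) (at z)"
      by (simp add: g'c)
    from has_derivative_snd[OF has_derivative_snd[OF this]]
    have "(w has_field_derivative dw) (at z)"
      by (simp add: w_def[abs_def] has_field_derivative_def mult_commute_abs)
    with 1 show ?thesis by blast
  qed
  then have wh: "w holomorphic_on ball z0 r"
    unfolding holomorphic_on_open[OF open_ball] by blast
  from wder[of z0] r(1) base obtain dv dw where dw: "(w has_field_derivative dw) (at z0)"
    and lineq: "?G' (z0, cvec \<psi>, 0) (1, dv, dw) = (1, 0, 0)" by auto
  \<comment> \<open>First-order perturbation: pairing the linearized eigenvalue equation with \<open>\<psi>\<close>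
    removes the unknown derivative of the eigenvector.\<close>
  from lineq have "H' z0 *v cvec \<psi> + map_matrix of_real A *v dv = dw *s cvec \<psi>"
    by (simp add: pencil_deriv_def A(1))
  then have "dw * (\<Sum>i\<in>UNIV. of_real (\<psi> $ i) * of_real (\<psi> $ i))
    = (\<Sum>i\<in>UNIV. of_real (\<psi> $ i) * (H' z0 *v cvec \<psi> + map_matrix of_real A *v dv) $ i)"
    by (simp add: sum_distrib_left mult_ac)
  also have "\<dots> = (\<Sum>i\<in>UNIV. of_real (\<psi> $ i) * (H' z0 *v cvec \<psi>) $ i)"
    using symmetric_kernel_orthogonal_range[OF A(2,3), of dv]
    by (simp add: distrib_left sum.distrib)
  finally have "deriv w z0 * of_real (\<psi> \<bullet> \<psi>) = (\<Sum>i\<in>UNIV. of_real (\<psi> $ i) * (H' z0 *v cvec \<psi>) $ i)"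
    unfolding sum_of_real_inner DERIV_imp_deriv[OF dw] .
  moreover have "pencil_map H \<psi> (z, v z, w z) = (z, 0, of_real (\<psi> \<bullet> \<psi>))" if "z \<in> ball z0 r" for z
    using Gg[OF YV[OF that]] gY[OF that] by (simp add: Y_def)
  moreover have "(z, v z, w z) \<in> U" if "z \<in> ball z0 r" for z
    using gU[OF YV[OF that]] gY[OF that] by simp
  ultimately show ?thesis
    using that[of U r w v] U(1,3) inj r(1) wh vc base by (simp add: p0_def)
qed

section \<open>Analytic branches at a simple eigenvalue\<close>

text \<open>Since \<open>A k\<close> and \<open>g k\<close> are close to \<open>A k0\<close> and \<open>0\<close>, an eigenvector is almost annihilated by
  \<open>A k0\<close>; as \<open>A k0\<close> is injective modulo \<open>\<psi>\<close>, it is almost parallel to \<open>\<psi>\<close>. No eigenvector has to be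
  chosen continuously in \<open>k\<close>.\<close>

lemma eventually_eigenvector_near_kernel:
  fixes A :: "real \<Rightarrow> real ^ 'n ^ 'n" and \<psi> :: "real ^ 'n"
  assumes "isCont A k0" "isCont g k0" "g k0 = 0" "\<psi> \<noteq> 0" "A k0 *v \<psi> = 0"
    and ker: "\<And>x. A k0 *v x = 0 \<Longrightarrow> \<exists>c. x = c *\<^sub>R \<psi>"
    and \<delta>: "\<delta> > 0"
  shows "\<forall>\<^sub>F k in nhds k0. \<forall>x. x \<noteq> 0 \<and> A k *v x = g k *\<^sub>R x \<longrightarrow>
           (\<exists>c. norm (c *\<^sub>R x - \<psi>) < \<delta> \<and> \<psi> \<bullet> (c *\<^sub>R x) = \<psi> \<bullet> \<psi>)"
proof -
  \<comment> \<open>On a direction orthogonal to the kernel line, \<open>A k0\<close> is bounded below; adjoining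
    the coordinate along \<open>\<psi>\<close> turns this into a bound \<open>B\<close> valid for all vectors.\<close>
  define L where "L x = (A k0 *v x, \<psi> \<bullet> x)" for x
  have lin: "linear L"
    by (auto simp: L_def linear_iff matrix_vector_right_distrib inner_add_right
        matrix_vector_mult_scaleR)
  have "inj L"
    unfolding linear_injective_0[OF lin]
  proof (intro allI impI)
    fix x assume "L x = 0"
    then have x: "A k0 *v x = 0" "\<psi> \<bullet> x = 0" by (auto simp: L_def zero_prod_def)
    then obtain c where "x = c *\<^sub>R \<psi>" using ker by blast
    with x(2) assms(4) show "x = 0" by simp
  qed
  then obtain B where B: "B > 0" "\<And>x. B * norm x \<le> norm (L x)"
    using linear_inj_bounded_below_pos[OF lin] by metis
  have bound: "B * norm x \<le> norm (A k0 *v x) + \<bar>\<psi> \<bullet> x\<bar>" for x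
    using B(2)[of x] norm_Pair_le[of "A k0 *v x" "\<psi> \<bullet> x"] by (simp add: L_def)
  define \<eta> where "\<eta> k = (\<Sum>i\<in>UNIV. \<Sum>j\<in>UNIV. \<bar>(A k - A k0) $ i $ j\<bar>) + \<bar>g k\<bar>" for k
  have "isCont \<eta> k0"
    unfolding \<eta>_def by (intro continuous_intros isCont_vec_nth assms)
  moreover have "\<eta> k0 = 0" using assms(3) by (simp add: \<eta>_def)
  ultimately have \<eta>: "(\<eta> \<longlongrightarrow> 0) (nhds k0)"
    by (metis isCont_def tendsto_at_iff_tendsto_nhds)
  \<comment> \<open>The first bound keeps the \<open>\<psi>\<close>-coordinate of an eigenvector away from \<open>0\<close>, so that it can be
    normalized; the second brings the normalized vector within \<open>\<delta>\<close> of \<open>\<psi>\<close>.\<close>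
  define \<epsilon> where "\<epsilon> = min (B / 2) (B\<^sup>2 * \<delta> / (2 * (\<psi> \<bullet> \<psi>)))"
  have pp: "\<psi> \<bullet> \<psi> > 0" using assms(4) by simp
  have "\<epsilon> > 0" using B(1) pp \<delta> by (simp add: \<epsilon>_def)
  then have "\<forall>\<^sub>F k in nhds k0. \<eta> k < \<epsilon>" using \<eta> by (rule order_tendstoD(2)[rotated])
  then show ?thesis
  proof eventually_elim
    case (elim k)
    then have \<eta>1: "\<eta> k < B / 2" and \<eta>2: "\<eta> k * (2 * (\<psi> \<bullet> \<psi>)) < B\<^sup>2 * \<delta>"
      using pp by (auto simp: \<epsilon>_def pos_less_divide_eq)
    show ?case
    proof (intro allI impI, elim conjE)
      fix x assume x: "x \<noteq> 0" "A k *v x = g k *\<^sub>R x"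
      have small: "norm (A k0 *v (c *\<^sub>R x)) \<le> \<eta> k * norm (c *\<^sub>R x)" for c
      proof -
        have "A k0 *v (c *\<^sub>R x) = g k *\<^sub>R (c *\<^sub>R x) - (A k - A k0) *v (c *\<^sub>R x)"
          using x(2) by (simp add: matrix_vector_mult_diff_rdistrib matrix_vector_mult_scaleR algebra_simps)
        also have "norm \<dots> \<le> norm (g k *\<^sub>R (c *\<^sub>R x)) + norm ((A k - A k0) *v (c *\<^sub>R x))"
          by (rule norm_triangle_ineq4)
        also have "\<dots> \<le> \<eta> k * norm (c *\<^sub>R x)"
          using norm_matrix_vector_le[of "A k - A k0" "c *\<^sub>R x"] norm_scaleR[of "g k" "c *\<^sub>R x"]
          unfolding \<eta>_def distrib_right by linarith
        finally show ?thesis .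
      qed
      have lower: "B / 2 * norm (c *\<^sub>R x) \<le> \<bar>\<psi> \<bullet> (c *\<^sub>R x)\<bar>" for c
      proof -
        have "\<eta> k * norm (c *\<^sub>R x) \<le> B / 2 * norm (c *\<^sub>R x)"
          using \<eta>1 by (intro mult_right_mono) auto
        then show ?thesis using bound[of "c *\<^sub>R x"] small[of c] by linarith
      qed
      have "0 < B / 2 * norm x" using B(1) x(1) by simp
      then have nz: "\<psi> \<bullet> x \<noteq> 0" using lower[of 1] by auto
      define c where "c = (\<psi> \<bullet> \<psi>) / (\<psi> \<bullet> x)"
      have c: "\<psi> \<bullet> (c *\<^sub>R x) = \<psi> \<bullet> \<psi>" using nz by (simp add: c_def)
      have "B * (B * norm (c *\<^sub>R x - \<psi>)) \<le> B * norm (A k0 *v (c *\<^sub>R x))"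
        using bound[of "c *\<^sub>R x - \<psi>"] c assms(5) B(1)
        by (intro mult_left_mono) (auto simp: matrix_vector_mult_diff_distrib inner_diff_right)
      also have "\<dots> \<le> \<eta> k * (B * norm (c *\<^sub>R x))"
        using small[of c] B(1) by (simp add: mult.left_commute)
      also have "\<dots> \<le> \<eta> k * (2 * (\<psi> \<bullet> \<psi>))"
        using lower[of c] c pp by (intro mult_left_mono) (auto simp: \<eta>_def intro!: add_nonneg_nonneg sum_nonneg)
      also have "\<dots> < B * (B * \<delta>)" using \<eta>2 by (simp add: power2_eq_square)
      finally have "norm (c *\<^sub>R x - \<psi>) < \<delta>" using B(1) by simp
      with c show "\<exists>c. norm (c *\<^sub>R x - \<psi>) < \<delta> \<and> \<psi> \<bullet> (c *\<^sub>R x) = \<psi> \<bullet> \<psi>" by blast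
    qed
  qed
qed

lemma real_analytic_at_imp_isCont:
  assumes "real_analytic_at f x"
  shows "isCont f x"
proof -
  obtain a r where r: "r > 0" and s: "\<And>y. \<bar>y - x\<bar> < r \<Longrightarrow> (\<lambda>n. a n * (y - x) ^ n) sums f y"
    using assms unfolding real_analytic_at_def by blast
  have "(\<lambda>n. a n * h ^ n) sums f (x + h)" if "norm h < r" for h
    using s[of "x + h"] that by simp
  then have "((\<lambda>h. f (x + h)) \<longlongrightarrow> a 0) (at 0)"
    by (rule powser_limit_0[OF r])
  moreover have "f x = a 0"
  proof -
    have "(\<lambda>n. a n * 0 ^ n) sums f x" using s[of x] r by simp
    moreover have "(\<lambda>n. a n * 0 ^ n) sums a 0" using powser_sums_zero[of a] by simp
    ultimately show ?thesis by (rule sums_unique2)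
  qed
  ultimately show ?thesis by (simp add: isCont_iff)
qed

text \<open>The slope is that of first-order perturbation theory, the Rayleigh quotient of \<open>D\<close> at \<open>\<psi>\<close>.
  A holomorphic extension \<open>H\<close> is used to express analyticity of the family because the implicit
  solution inherits it through complex differentiability alone.\<close>

lemma simple_eigenvalue_analytic_branch:
  fixes A :: "real \<Rightarrow> real ^ 'n ^ 'n" and H :: "complex \<Rightarrow> complex ^ 'n ^ 'n" and \<psi> :: "real ^ 'n"
  assumes S: "open S" "of_real k0 \<in> S" and hol: "\<And>i j. (\<lambda>z. H z $ i $ j) holomorphic_on S"
    and ext: "\<And>k. of_real k \<in> S \<Longrightarrow> H (of_real k) = map_matrix of_real (A k)"
    and sym: "transpose (A k0) = A k0" and \<psi>: "A k0 *v \<psi> = 0" "\<psi> \<noteq> 0"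
    and ker: "\<And>x. A k0 *v x = 0 \<Longrightarrow> \<exists>c. x = c *\<^sub>R \<psi>"
    and D: "(A has_vector_derivative D) (at k0)"
  shows "\<exists>f. analytic_eigenvalue_branch A k0 f \<and> f k0 = 0
           \<and> (\<forall>g. analytic_eigenvalue_branch A k0 g \<and> g k0 = 0 \<longrightarrow> (\<forall>\<^sub>F k in nhds k0. g k = f k))
           \<and> (f has_real_derivative (\<psi> \<bullet> (D *v \<psi>)) / (\<psi> \<bullet> \<psi>)) (at k0)"
proof -
  define H' where "H' z = (\<chi> i j. deriv (\<lambda>z. H z $ i $ j) z)" for z
  let ?z0 = "complex_of_real k0" and ?G = "pencil_map H \<psi>"
  obtain U r w v where U: "open U" "(?z0, cvec \<psi>, 0) \<in> U" "inj_on ?G U" and r: "r > 0"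
    and w: "w holomorphic_on ball ?z0 r" and v: "continuous_on (ball ?z0 r) v"
    and base: "v ?z0 = cvec \<psi>" "w ?z0 = 0"
    and inU: "\<And>z. z \<in> ball ?z0 r \<Longrightarrow> (z, v z, w z) \<in> U"
    and G: "\<And>z. z \<in> ball ?z0 r \<Longrightarrow> ?G (z, v z, w z) = (z, 0, of_real (\<psi> \<bullet> \<psi>))"
    and w': "deriv w ?z0 * of_real (\<psi> \<bullet> \<psi>) = (\<Sum>i\<in>UNIV. of_real (\<psi> $ i) * (H' ?z0 *v cvec \<psi>) $ i)"
    unfolding H'_def by (rule holomorphic_eigenpair[OF S hol ext[OF S(2)] sym \<psi>], erule ker, rule that[unfolded H'_def])
  define f where "f k = Re (w (of_real k))" for k
  have pp: "\<psi> \<bullet> \<psi> > 0" using \<psi>(2) by simp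
  have [simp]: "continuous_on X complex_of_real" for X
    by (intro continuous_intros)
  have evS: "\<forall>\<^sub>F k in nhds k0. of_real k \<in> S"
    using eventually_nhds_in_open[OF open_vimage[OF S(1), of complex_of_real]] S(2) by simp
  have evB: "\<forall>\<^sub>F k in nhds k0. complex_of_real k \<in> ball ?z0 r"
    using eventually_nhds_in_open[OF open_ball[of k0 r]] r by simp

  have analytic: "real_analytic_at f k0"
    unfolding real_analytic_at_def
  proof (intro exI conjI allI impI)
    show "r > 0" by (rule r)
    fix y :: real assume "\<bar>y - k0\<bar> < r"
    then have y: "complex_of_real y \<in> ball ?z0 r"
      by (simp add: dist_norm norm_minus_commute flip: of_real_diff)
    have "Re (a * (of_real y - ?z0) ^ n) = Re a * (y - k0) ^ n" for a n
      by (simp flip: of_real_diff of_real_power)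
    with sums_Re[OF holomorphic_power_series[OF w y]]
    show "(\<lambda>n. Re ((deriv ^^ n) w ?z0 / fact n) * (y - k0) ^ n) sums f y"
      by (simp only: f_def)
  qed

  \<comment> \<open>At a real parameter the conjugate of the eigenpair solves the same equations; it lies in
    \<open>U\<close> near \<open>k0\<close>, so injectivity there makes the eigenpair real.\<close>
  define cq where "cq k = (complex_of_real k, (\<chi> i. cnj (v (of_real k) $ i)), cnj (w (of_real k)))" for k
  have "isCont v ?z0" "isCont w ?z0"
    using v holomorphic_on_imp_continuous_on[OF w] r by (auto simp: continuous_on_eq_continuous_at)
  then have "isCont (\<lambda>k. v (of_real k)) k0" "isCont (\<lambda>k. w (of_real k)) k0"
    using isCont_o2[of k0 complex_of_real v] isCont_o2[of k0 complex_of_real w] by simp_all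
  then have "isCont cq k0"
    unfolding cq_def isCont_def
    by (intro tendsto_intros) auto
  moreover have "cq k0 \<in> U" using U(2) base by (simp add: cq_def cvec_def)
  ultimately have evC: "\<forall>\<^sub>F k in nhds k0. cq k \<in> U"
    unfolding isCont_def tendsto_at_iff_tendsto_nhds using U(1) by (auto dest: topological_tendstoD)

  have eig: "\<forall>\<^sub>F k in nhds k0. is_eigenvalue (A k) (f k) \<and> w (of_real k) = of_real (f k)"
    using evS evB evC
  proof eventually_elim
    case (elim k)
    let ?v = "v (of_real k)" and ?w = "w (of_real k)"
    have e: "map_matrix of_real (A k) *v ?v = ?w *s ?v"
      and n: "(\<Sum>i\<in>UNIV. of_real (\<psi> $ i) * ?v $ i) = of_real (\<psi> \<bullet> \<psi>)"
      using G[OF elim(2)] by (auto simp: pencil_map_def ext[OF elim(1)])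
    have "(map_matrix of_real (A k) *v (\<chi> i. cnj (?v $ i))) $ i = cnj ((map_matrix of_real (A k) *v ?v) $ i)" for i
      by (simp add: matrix_vector_mult_def)
    then have e': "map_matrix of_real (A k) *v (\<chi> i. cnj (?v $ i)) = cnj ?w *s (\<chi> i. cnj (?v $ i))"
      unfolding e by (simp add: vec_eq_iff)
    have n': "(\<Sum>i\<in>UNIV. of_real (\<psi> $ i) * cnj (?v $ i)) = of_real (\<psi> \<bullet> \<psi>)"
      using arg_cong[OF n, of cnj] by simp
    have "?G (cq k) = ?G (of_real k, ?v, ?w)"
      using e e' n n' by (simp add: cq_def pencil_map_def ext[OF elim(1)])
    then have "cq k = (of_real k, ?v, ?w)"
      using U(3) elim(3) inU[OF elim(2)] by (simp add: inj_on_eq_iff)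
    then have cw: "cnj ?w = ?w" and cv: "\<And>i. cnj (?v $ i) = ?v $ i"
      by (auto simp: cq_def vec_eq_iff)
    define x where "x = (\<chi> i. Re (?v $ i))"
    have wf: "?w = of_real (f k)" using cw by (simp add: f_def complex_eq_iff)
    have vx: "?v = cvec x" using cv by (simp add: x_def vec_eq_iff complex_eq_iff)
    have "cvec (A k *v x) = cvec (f k *\<^sub>R x)"
      using e unfolding wf vx by (simp add: vec_eq_iff matrix_vector_mult_def)
    then have "A k *v x = f k *\<^sub>R x"
      unfolding vec_eq_iff cvec_nth of_real_eq_iff .
    moreover have "x \<noteq> 0"
      using n pp unfolding vx cvec_nth sum_of_real_inner by auto
    ultimately show ?case using wf unfolding is_eigenvalue_def by blast
  qed

  have unique: "\<forall>\<^sub>F k in nhds k0. g k = f k" if "analytic_eigenvalue_branch A k0 g" "g k0 = 0" for g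
  proof -
    define T where "T = (\<lambda>(k, x, m). (complex_of_real k, cvec x, complex_of_real m)) -` U"
    have "continuous_on UNIV (\<lambda>(k, x, m). (complex_of_real k, cvec x :: complex ^ 'n, complex_of_real m))"
      unfolding case_prod_unfold cvec_def by (intro continuous_intros)
    then have "open T" unfolding T_def by (rule open_vimage[OF U(1)])
    have "(k0, \<psi>, 0) \<in> T" using U(2) by (simp add: T_def)
    obtain K X M where K: "open K" "k0 \<in> K" and X: "open X" "\<psi> \<in> X" and M: "open M" "0 \<in> M"
      and T: "K \<times> X \<times> M \<subseteq> T"
    proof -
      from \<open>open T\<close> \<open>(k0, \<psi>, 0) \<in> T\<close> obtain K R where "open K" "open R" "(k0, \<psi>, 0) \<in> K \<times> R" "K \<times> R \<subseteq> T"
        by (rule open_prod_elim)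
      moreover from this have "(\<psi>, 0) \<in> R" by simp
      with \<open>open R\<close> obtain X M where "open X" "open M" "(\<psi>, 0) \<in> X \<times> M" "X \<times> M \<subseteq> R"
        by (rule open_prod_elim)
      ultimately show ?thesis by (intro that[of K X M]) auto
    qed
    obtain \<delta> where \<delta>: "\<delta> > 0" "ball \<psi> \<delta> \<subseteq> X" using X by (metis openE)
    have gc: "isCont g k0" using that(1) real_analytic_at_imp_isCont by (auto simp: analytic_eigenvalue_branch_def)
    have Ac: "isCont A k0" using D by (rule has_vector_derivative_continuous)
    have "(g \<longlongrightarrow> 0) (nhds k0)" using gc that(2) by (metis isCont_def tendsto_at_iff_tendsto_nhds)
    then have evM: "\<forall>\<^sub>F k in nhds k0. g k \<in> M" using M by (rule topological_tendstoD)
    have evE: "\<forall>\<^sub>F k in nhds k0. is_eigenvalue (A k) (g k)"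
      using that(1) by (simp add: analytic_eigenvalue_branch_def)
    have "\<forall>\<^sub>F k in nhds k0. \<forall>x. x \<noteq> 0 \<and> A k *v x = g k *\<^sub>R x \<longrightarrow>
           (\<exists>c. norm (c *\<^sub>R x - \<psi>) < \<delta> \<and> \<psi> \<bullet> (c *\<^sub>R x) = \<psi> \<bullet> \<psi>)"
      using Ac gc that(2) \<psi>(2,1) ker \<delta>(1) by (rule eventually_eigenvector_near_kernel)
    then show ?thesis
      using evM evE evS evB eventually_nhds_in_open[OF K]
    proof eventually_elim
      case (elim k)
      then obtain x c where x: "A k *v x = g k *\<^sub>R x" "norm (c *\<^sub>R x - \<psi>) < \<delta>" "\<psi> \<bullet> (c *\<^sub>R x) = \<psi> \<bullet> \<psi>"
        unfolding is_eigenvalue_def by metis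
      define y where "y = c *\<^sub>R x"
      have "y \<in> X" using x(2) \<delta>(2) by (auto simp: y_def dist_norm norm_minus_commute)
      then have "(k, y, g k) \<in> T" using T elim(2,6) by blast
      then have yU: "(of_real k, cvec y, of_real (g k)) \<in> U" by (simp add: T_def)
      have "A k *v y = g k *\<^sub>R y" using x(1) by (simp add: y_def matrix_vector_mult_scaleR)
      then have "map_matrix of_real (A k) *v cvec y = of_real (g k) *s cvec y"
        by (simp add: vec_eq_iff matrix_vector_mult_def flip: of_real_mult of_real_sum)
      then have "?G (of_real k, cvec y, of_real (g k)) = ?G (of_real k, v (of_real k), w (of_real k))"
        using x(3) unfolding G[OF elim(5)]
        by (simp add: pencil_map_def ext[OF elim(4)] sum_of_real_inner flip: y_def)
      then have "of_real (g k) = w (of_real k)"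
        using U(3) yU inU[OF elim(5)] by (simp add: inj_on_eq_iff)
      then show ?case by (metis f_def Re_complex_of_real)
    qed
  qed

  have H'D: "H' ?z0 $ i $ j = of_real (D $ i $ j)" for i j
  proof -
    have "((\<lambda>z. H z $ i $ j) has_field_derivative H' ?z0 $ i $ j) (at ?z0)"
      using holomorphic_derivI[OF hol S(1,2)] by (simp add: H'_def)
    then have 1: "((\<lambda>k. H (of_real k) $ i $ j) has_vector_derivative H' ?z0 $ i $ j) (at k0)"
      by (rule has_vector_derivative_real_field)
    have "((\<lambda>k. A k $ i $ j) has_vector_derivative D $ i $ j) (at k0)"
      using bounded_linear.has_vector_derivative[OF bounded_linear_vec_nth
          bounded_linear.has_vector_derivative[OF bounded_linear_vec_nth D]] .
    then have "((\<lambda>k. complex_of_real (A k $ i $ j)) has_vector_derivative of_real (D $ i $ j)) (at k0)"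
      by (rule bounded_linear.has_vector_derivative[OF bounded_linear_of_real])
    then have 2: "((\<lambda>k. H (of_real k) $ i $ j) has_vector_derivative of_real (D $ i $ j)) (at k0)"
      by (rule has_vector_derivative_transform_within_open[where S = "complex_of_real -` S"])
        (use S ext in \<open>auto intro!: open_vimage\<close>)
    show ?thesis by (rule vector_derivative_unique_at[OF 1 2])
  qed
  have "deriv w ?z0 * of_real (\<psi> \<bullet> \<psi>) = (\<Sum>i\<in>UNIV. of_real (\<psi> $ i) * of_real ((D *v \<psi>) $ i))"
    unfolding w' by (simp add: matrix_vector_mult_def H'D)
  then have "deriv w ?z0 = of_real ((\<psi> \<bullet> (D *v \<psi>)) / (\<psi> \<bullet> \<psi>))"
    using pp unfolding sum_of_real_inner by (simp add: eq_divide_eq)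
  then have "(w has_field_derivative of_real ((\<psi> \<bullet> (D *v \<psi>)) / (\<psi> \<bullet> \<psi>))) (at ?z0)"
    using holomorphic_derivI[OF w open_ball, of ?z0] r by simp
  from bounded_linear.has_vector_derivative[OF bounded_linear_Re has_vector_derivative_real_field[OF this]]
  have "(f has_real_derivative (\<psi> \<bullet> (D *v \<psi>)) / (\<psi> \<bullet> \<psi>)) (at k0)"
    unfolding has_real_derivative_iff_has_vector_derivative f_def Re_complex_of_real .
  moreover have "analytic_eigenvalue_branch A k0 f"
    using analytic eig by (auto simp: analytic_eigenvalue_branch_def elim: eventually_mono)
  moreover have "f k0 = 0" using base by (simp add: f_def)
  ultimately show ?thesis using unique by blast
qed

section \<open>The radial path of the crossed graph\<close>

definition complex_edge_block :: "edge_ends \<Rightarrow> complex \<Rightarrow> complex ^ vertex ^ vertex" where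
  "complex_edge_block d z = (\<chi> i j. case d of
       Internal v w \<Rightarrow>
         if i = j \<and> (i = v \<or> i = w) then - cot z
         else if (i = v \<and> j = w) \<or> (i = w \<and> j = v) then 1 / sin z
         else 0
     | Terminal v b \<Rightarrow> if i = v \<and> j = v then - cot z else 0)"

definition complex_kirchhoff_matrix :: "real ^ edge \<Rightarrow> complex \<Rightarrow> complex ^ vertex ^ vertex" where
  "complex_kirchhoff_matrix l z = (\<Sum>e\<in>UNIV. complex_edge_block (ends e) (z * of_real (l $ e)))"

lemma complex_kirchhoff_matrix_of_real:
  "complex_kirchhoff_matrix l (of_real k) = map_matrix of_real (kirchhoff_matrix (k *\<^sub>R l))"
proof -
  have "complex_edge_block d (of_real t) $ i $ j = of_real (edge_block d t $ i $ j)" for d t i j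
    by (cases d) (auto simp: complex_edge_block_def edge_block_def cot_def sin_of_real cos_of_real)
  from this[of _ "k * l $ e" for e]
  show ?thesis
    by (simp add: complex_kirchhoff_matrix_def kirchhoff_matrix_def vec_eq_iff)
qed

lemma complex_kirchhoff_matrix_holomorphic:
  "(\<lambda>z. complex_kirchhoff_matrix l z $ i $ j) holomorphic_on {z. \<forall>e. sin (z * of_real (l $ e)) \<noteq> 0}"
proof -
  let ?S = "{z. \<forall>e. sin (z * of_real (l $ e)) \<noteq> 0}"
  have if_hol: "(\<lambda>z. if P then f z else g z) holomorphic_on X"
    if "f holomorphic_on X" "g holomorphic_on X" for P X and f g :: "complex \<Rightarrow> complex"
    using that by (cases P) auto
  have "(\<lambda>z. - cot (z * of_real (l $ e))) holomorphic_on ?S"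
    "(\<lambda>z. 1 / sin (z * of_real (l $ e))) holomorphic_on ?S" for e
    unfolding cot_def by (auto intro!: holomorphic_intros)
  then have "(\<lambda>z. complex_edge_block d (z * of_real (l $ e)) $ i $ j) holomorphic_on ?S" for d e
    by (cases d) (simp_all add: complex_edge_block_def if_hol)
  then show ?thesis
    unfolding complex_kirchhoff_matrix_def sum_component by (intro holomorphic_intros)
qed

lemma transpose_kirchhoff_matrix: "transpose (kirchhoff_matrix \<theta>) = kirchhoff_matrix \<theta>"
proof -
  have "edge_block d t $ i $ j = edge_block d t $ j $ i" for d t i j
    by (cases d) (auto simp: edge_block_def)
  then show ?thesis
    by (simp add: transpose_def kirchhoff_matrix_def vec_eq_iff)
qed

theorem lemma8p1:
  fixes \<theta> l :: "real ^ edge" and N :: "nat ^ edge" and \<phi> :: "complex ^ vertex"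
  assumes "nonsingular_phase \<theta>"
    and "\<phi> \<in> complex_kernel (kirchhoff_matrix \<theta>)" and "\<phi> \<noteq> 0"
    and "l = (\<chi> e. \<theta> $ e + 2 * pi * real (N $ e))" and "\<forall>e. l $ e > 0"
  shows "(\<exists>D. ((\<lambda>k. kirchhoff_matrix (k *\<^sub>R l)) has_vector_derivative D) (at 1)
             \<and> hermitian_form D \<phi>
                 = complex_of_real (\<Sum>e\<in>UNIV. l $ e * edge_energy \<theta> \<phi> e))
       \<and> (\<Sum>e\<in>UNIV. l $ e * edge_energy \<theta> \<phi> e) > 0
       \<and> (vec.dim (complex_kernel (kirchhoff_matrix \<theta>)) = 1 \<longrightarrow>
            (\<exists>f. analytic_eigenvalue_branch (\<lambda>k. kirchhoff_matrix (k *\<^sub>R l)) 1 f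
               \<and> f 1 = 0
               \<and> (\<forall>g. analytic_eigenvalue_branch (\<lambda>k. kirchhoff_matrix (k *\<^sub>R l)) 1 g \<and> g 1 = 0
                       \<longrightarrow> (\<forall>\<^sub>F k in nhds 1. g k = f k))
               \<and> f differentiable at 1 \<and> deriv f 1 \<noteq> 0))"
proof -
  \<comment> \<open>The shift by full periods leaves every trigonometric function of the phases unchanged,
    so \<open>\<theta>\<close> enters only as a representative of \<open>l\<close>.\<close>
  have sin_l: "sin (l $ e) = sin (\<theta> $ e)" and cos_l: "cos (l $ e) = cos (\<theta> $ e)" for e
    using sin_2npi[of "N $ e"] cos_2npi[of "N $ e"]
    by (simp_all add: assms(4) sin_add cos_add mult.commute mult.left_commute)
  have cot_l: "cot (l $ e) = cot (\<theta> $ e)" for e by (simp add: cot_def sin_l cos_l)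
  have sin_nz: "sin (l $ e) \<noteq> 0" for e
    using assms(1) unfolding sin_l nonsingular_phase_def sin_zero_iff_int2 by (metis mult.commute)
  have energy: "edge_energy l \<eta> e = edge_energy \<theta> \<eta> e" for \<eta> e
    by (simp add: edge_energy_def endpoint_energy_def outward_deriv_def sin_l cos_l cot_l
        split: edge_ends.split)
  have M_l: "kirchhoff_matrix l = kirchhoff_matrix \<theta>"
  proof -
    have "edge_block d (l $ e) $ i $ j = edge_block d (\<theta> $ e) $ i $ j" for d e i j
      unfolding edge_block_def vec_lambda_beta sin_l cot_l ..
    then show ?thesis by (simp add: kirchhoff_matrix_def vec_eq_iff)
  qed
  let ?M = "\<lambda>k. kirchhoff_matrix (k *\<^sub>R l)"
  define D where "D = (\<Sum>e\<in>UNIV. l $ e *\<^sub>R edge_block_deriv (ends e) (l $ e))"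
  have D: "(?M has_vector_derivative D) (at 1)"
    unfolding D_def by (rule kirchhoff_matrix_has_vector_derivative[OF sin_nz])
  have form: "hermitian_form D \<eta> = of_real (\<Sum>e\<in>UNIV. l $ e * edge_energy \<theta> \<eta> e)" for \<eta>
    by (simp add: D_def hermitian_form_sum_scaleR hermitian_form_edge_block_deriv[OF sin_nz] energy)
  have branch: "\<exists>f. analytic_eigenvalue_branch ?M 1 f \<and> f 1 = 0
      \<and> (\<forall>g. analytic_eigenvalue_branch ?M 1 g \<and> g 1 = 0 \<longrightarrow> (\<forall>\<^sub>F k in nhds 1. g k = f k))
      \<and> f differentiable at 1 \<and> deriv f 1 \<noteq> 0"
    if dim: "vec.dim (complex_kernel (kirchhoff_matrix \<theta>)) = 1"
  proof -
    obtain \<psi> where \<psi>: "?M 1 *v \<psi> = 0" "\<psi> \<noteq> 0" and ker: "\<And>x. ?M 1 *v x = 0 \<Longrightarrow> \<exists>c. x = c *\<^sub>R \<psi>"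
      using real_kernel_line[OF assms(2,3) dim] by (auto simp: M_l)
    let ?S = "{z. \<forall>e. sin (z * of_real (l $ e)) \<noteq> (0::complex)}"
    have "?S = (\<Inter>e. {z. sin (z * of_real (l $ e)) \<noteq> 0})" by auto
    also have "open \<dots>"
      by (intro open_INT finite ballI open_Collect_neq continuous_intros)
    finally have S: "open ?S" .
    have 1: "of_real 1 \<in> ?S" using sin_nz by (simp add: sin_of_real)
    obtain f where f: "analytic_eigenvalue_branch ?M 1 f" "f 1 = 0"
        "\<forall>g. analytic_eigenvalue_branch ?M 1 g \<and> g 1 = 0 \<longrightarrow> (\<forall>\<^sub>F k in nhds 1. g k = f k)"
      and f': "(f has_real_derivative (\<psi> \<bullet> (D *v \<psi>)) / (\<psi> \<bullet> \<psi>)) (at 1)"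
      using simple_eigenvalue_analytic_branch[OF S 1 complex_kirchhoff_matrix_holomorphic
          complex_kirchhoff_matrix_of_real transpose_kirchhoff_matrix \<psi> ker D]
      by blast
    \<comment> \<open>The energy identity, for the state of \<open>\<psi>\<close>, is the numerator of the slope.\<close>
    have nz: "cvec \<psi> \<noteq> 0" using \<psi>(2) by (auto simp: vec_eq_iff)
    have "\<psi> \<bullet> (D *v \<psi>) > 0"
      using weighted_edge_energy_pos[OF nz assms(5), of \<theta>] form[of "cvec \<psi>"]
      by (simp only: hermitian_form_cvec of_real_eq_iff)
    then have "deriv f 1 \<noteq> 0" using DERIV_imp_deriv[OF f'] \<psi>(2) by simp
    moreover have "f differentiable at 1"
      using f' by (auto simp: real_differentiable_def)
    ultimately show ?thesis using f by blast
  qed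
  show ?thesis
    using D form[of \<phi>] weighted_edge_energy_pos[OF assms(3,5)] branch by blast
qed

end
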